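(* Let $\phi=\pi_R\circ h\circ\eta\circ\pi_2$; that is, $\phi$ sends $x\in[0,1)\setminus\mathbb{D}$ with binary expansion $x=0.b_{k_1}b_{k_2}b_{k_3}\dots$ (written as a concatenation of the blocks $b_k$) to the number with backward continued fraction $[k_1+2,k_2+2,k_3+2,\dots]$. Then $\phi:[0,1)\setminus\mathbb{D}\to[0,1)\setminus\mathbb{Q}$ is a homeomorphism and $$\phi\circ D_2=T\circ\phi$$ on $[0,1)\setminus\mathbb{D}$.
   Context: $\mathbb{N}=\{1,2,\dots\}$ and $[y]$ denotes the integer part (floor) of a real $y$. $\mathbb{D}=\{k/2^n\in[0,1): k\in\mathbb{N}\cup\{0\},\,n\in\mathbb{N}\}$ is the set of dyadic numbers in $[0,1)$. The map $T:[0,1)\to[0,1)$ is $T(x)=\dfrac{1}{2\left[\frac{1}{1-x}\right]+1-\frac{1}{1-x}}$. The interval dyadic odometer $D_2:[0,1)\to[0,1)$ is defined by $D_2(x)=x+\frac{3}{2^n}-1$ for $x\in I_n=\left[\frac{2^{n-1}-1}{2^{n-1}},\frac{2^n-1}{2^n}\right)$, $n\in\mathbb{N}$. Sequence spaces $\{0,1\}^{\mathbb{N}}$ and $\Sigma_{\ge n}=\{n,n+1,\dots\}^{\mathbb{N}}$ carry the product topology of discrete topologies. $\Sigma_2^*\subset\{0,1\}^{\mathbb{N}}$ is the set of sequences not ending with a tail of $1$'s nor with a tail of $0$'s. The map $\pi_2:[0,1)\setminus\mathbb{D}\to\Sigma_2^*$ sends $x$ to its binary expansion. For $k\ge0$ let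 $b_k$ be the block consisting of $k$ ones followed by a single $0$ (so $b_0=0$). Every sequence in $\Sigma_2^*$ is uniquely a concatenation $b_{k_1}b_{k_2}\dots$ with $k_i\ge0$, and $\eta$ sends it to $(k_1,k_2,\dots)\in\Sigma_{\ge0}$. The map $h:\Sigma_{\ge0}\to\Sigma_{\ge2}$ is $h(a_1,a_2,\dots)=(a_1+2,a_2+2,\dots)$. The map $\pi_R:\Sigma_{\ge2}\to[0,1)$ sends $(w_1,w_2,\dots)$ to the value of the backward continued fraction $$[w_1,w_2,\dots]=1-\cfrac{1}{w_1-\cfrac{1}{w_2-\cfrac{1}{w_3-\cdots}}},$$ understood as the limit of finite truncations. *)

theory Defs
  imports "HOL-Analysis.Analysis"
begin

(* Sequences are functions on nat starting at index 0: the term written with index i in the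
   usual notation x_1, x_2, ... is the value at i - 1.  Maps on [0,1) are total functions on
   the reals; their values outside the stated domains carry no meaning. *)

definition dyadic_unit :: "real set" where
  "dyadic_unit = {real k / 2 ^ n | (k::nat) (n::nat). n \<ge> 1 \<and> real k / 2 ^ n \<in> {0..<1}}"

definition T_map :: "real \<Rightarrow> real" where
  "T_map x = 1 / (2 * of_int \<lfloor>1 / (1 - x)\<rfloor> + 1 - 1 / (1 - x))"

definition odometer_interval :: "nat \<Rightarrow> real set" where
  "odometer_interval n = {(2 ^ (n - 1) - 1) / 2 ^ (n - 1) ..< (2 ^ n - 1) / 2 ^ n}"

(* The intervals with n \<ge> 1 partition [0,1), so the index n is unique for x in [0,1). *)
definition D2 :: "real \<Rightarrow> real" where
  "D2 x = x + 3 / 2 ^ (THE n. n \<ge> 1 \<and> x \<in> odometer_interval n) - 1"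

definition Sigma2_star :: "(nat \<Rightarrow> nat) set" where
  "Sigma2_star = {s. range s \<subseteq> {0, 1} \<and>
     \<not> (\<exists>N. \<forall>i\<ge>N. s i = 1) \<and> \<not> (\<exists>N. \<forall>i\<ge>N. s i = 0)}"

definition pi_2 :: "real \<Rightarrow> nat \<Rightarrow> nat" where
  "pi_2 x = (THE s. s \<in> Sigma2_star \<and> (\<lambda>i. real (s i) / 2 ^ Suc i) sums x)"

definition block :: "nat \<Rightarrow> nat list" where
  "block k = replicate k 1 @ [0]"

(* s is the infinite concatenation of the blocks: every finite concatenation of initial blocks
   is an initial segment of s.  As blocks are nonempty, this determines s. *)
definition is_block_concat :: "(nat \<Rightarrow> nat) \<Rightarrow> (nat \<Rightarrow> nat) \<Rightarrow> bool" where
  "is_block_concat k s \<longleftrightarrow>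
     (\<forall>n. let p = concat (map (\<lambda>i. block (k i)) [0..<n]) in map s [0..<length p] = p)"

definition eta :: "(nat \<Rightarrow> nat) \<Rightarrow> nat \<Rightarrow> nat" where
  "eta s = (THE k. is_block_concat k s)"

definition h_shift :: "(nat \<Rightarrow> nat) \<Rightarrow> nat \<Rightarrow> nat" where
  "h_shift a = (\<lambda>i. a i + 2)"

(* minus_frac [w1, ..., wn] = 1 / (w1 - 1 / (w2 - ... - 1 / wn)) *)
fun minus_frac :: "nat list \<Rightarrow> real" where
  "minus_frac [] = 0"
| "minus_frac (w # ws) = 1 / (real w - minus_frac ws)"

definition pi_R :: "(nat \<Rightarrow> nat) \<Rightarrow> real" where
  "pi_R w = lim (\<lambda>n. 1 - minus_frac (map w [0..<n]))"

definition phi :: "real \<Rightarrow> real" where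
  "phi = pi_R \<circ> h_shift \<circ> eta \<circ> pi_2"

end

theory Submission
  imports Defs
begin

text \<open>Writing $v = \phi(y)$, the definition of $\phi$ gives $\phi(y/2) = v/(1+v)$ and
$\phi((1+y)/2) = 1/(2-v)$, so $\phi$ is the inverse of Minkowski's question mark function.
Both branches are increasing and their ranges are separated by $1/2$, whence $\phi$ is strictly
increasing. The inverse branches lower the denominator of a rational number in $(0,1)$;
descent on the denominator shows that the values of $\phi$ are irrational and that two irrational
numbers with the same itinerary coincide, which gives surjectivity. An increasing bijection
between dense subsets of $(0,1)$ is a homeomorphism. The conjugacy follows by induction on the
index of the interval $I_n$, since $D_2((1+y)/2) = D_2(y)/2$ and
$T(1/(2-v)) = T(v)/(1+T(v))$.\<close>

section \<open>Binary expansions\<close>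

text \<open>An explicit left inverse for \<open>pi_2\<close>: on \<open>Sigma2_star\<close> it
  inverts the definite description there and can be computed with digit by digit.\<close>

definition binary_value :: "(nat \<Rightarrow> nat) \<Rightarrow> real" where
  "binary_value s = (\<Sum>i. real (s i) / 2 ^ Suc i)"

lemma Sigma2_star_digit: "s \<in> Sigma2_star \<Longrightarrow> s i = 0 \<or> s i = 1"
  by (auto simp: Sigma2_star_def image_subset_iff)

lemma Sigma2_star_le_1: "s \<in> Sigma2_star \<Longrightarrow> s i \<le> 1"
  using Sigma2_star_digit[of s i] by auto

lemma Sigma2_star_shift:
  assumes "s \<in> Sigma2_star"
  shows "(\<lambda>i. s (i + n)) \<in> Sigma2_star"
proof -
  have "\<exists>N. \<forall>i\<ge>N. s i = c" if tail: "\<exists>N. \<forall>i\<ge>N. s (i + n) = c" for c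
  proof -
    obtain N where "\<forall>i\<ge>N. s (i + n) = c" using tail ..
    hence "s i = c" if "i \<ge> N + n" for i
      using that by (metis add_le_imp_le_right le_add2 le_add_diff_inverse2 le_trans)
    thus ?thesis by blast
  qed
  moreover have "range (\<lambda>i. s (i + n)) \<subseteq> {0, 1}"
    using assms by (auto simp: Sigma2_star_def image_subset_iff)
  ultimately show ?thesis using assms unfolding Sigma2_star_def by blast
qed

lemma Sigma2_star_Suc: "s \<in> Sigma2_star \<Longrightarrow> (\<lambda>i. s (Suc i)) \<in> Sigma2_star"
  using Sigma2_star_shift[of s 1] by simp

lemma Sigma2_star_Cons:
  assumes "s \<in> Sigma2_star" "c \<in> {0, 1}"
  shows "case_nat c s \<in> Sigma2_star"
proof -
  have "\<exists>N. \<forall>i\<ge>N. s i = d" if tail: "\<exists>N. \<forall>i\<ge>N. case_nat c s i = d" for d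
  proof -
    obtain N where N: "\<forall>i\<ge>N. case_nat c s i = d" using tail ..
    have "s i = d" if "i \<ge> N" for i using N[rule_format, of "Suc i"] that by simp
    thus ?thesis by blast
  qed
  moreover have "range (case_nat c s) \<subseteq> {0, 1}"
    using assms by (auto simp: Sigma2_star_def image_subset_iff split: nat.splits)
  ultimately show ?thesis using assms(1) unfolding Sigma2_star_def by blast
qed

lemma binary_value_sums:
  assumes "\<And>i. s i \<le> 1"
  shows "(\<lambda>i. real (s i) / 2 ^ Suc i) sums binary_value s"
proof -
  have "summable (\<lambda>i. (1/2::real) ^ Suc i)"
    using power_half_series sums_summable by blast
  hence "summable (\<lambda>i. real (s i) / 2 ^ Suc i)"
    by (rule summable_comparison_test') (use assms in \<open>auto simp: power_divide divide_right_mono\<close>)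
  thus ?thesis by (simp add: binary_value_def summable_sums)
qed

lemma binary_value_ge_0: "(\<And>i. s i \<le> 1) \<Longrightarrow> 0 \<le> binary_value s"
  by (rule sums_le[OF _ sums_zero binary_value_sums]) auto

lemma binary_value_le_1: "(\<And>i. s i \<le> 1) \<Longrightarrow> binary_value s \<le> 1"
  by (rule sums_le[OF _ binary_value_sums power_half_series])
     (auto simp: power_divide divide_right_mono)

text \<open>Splitting off the first digit halves the contribution of the tail. Most later facts
  about binary values follow from this recursion by induction on a position.\<close>

lemma binary_value_Suc:
  assumes "\<And>i. s i \<le> 1"
  shows "binary_value s = (real (s 0) + binary_value (\<lambda>i. s (Suc i))) / 2"
proof -
  have "(\<lambda>i. real (s (Suc i)) / 2 ^ Suc i) sums binary_value (\<lambda>i. s (Suc i))"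
    using assms by (intro binary_value_sums)
  from sums_divide[OF this, of 2]
  have "(\<lambda>i. real (s (Suc i)) / 2 ^ Suc (Suc i)) sums (binary_value (\<lambda>i. s (Suc i)) / 2)"
    by (simp add: field_simps)
  from sums_Suc[OF this] have "(\<lambda>i. real (s i) / 2 ^ Suc i) sums
      (binary_value (\<lambda>i. s (Suc i)) / 2 + real (s 0) / 2)" by simp
  with binary_value_sums[of s, OF assms] have "binary_value s =
      binary_value (\<lambda>i. s (Suc i)) / 2 + real (s 0) / 2" by (rule sums_unique2)
  thus ?thesis by (simp add: add_divide_distrib)
qed

lemma Sigma2_star_binary_value_Suc:
  assumes "s \<in> Sigma2_star"
  shows "binary_value s = (real (s 0) + binary_value (\<lambda>i. s (Suc i))) / 2"
  using Sigma2_star_le_1[OF assms] by (rule binary_value_Suc)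

lemma binary_value_pos:
  assumes "\<And>i. s i \<le> 1" "s i = 1"
  shows "binary_value s > 0"
  using assms
proof (induction i arbitrary: s)
  case 0
  thus ?case using binary_value_ge_0[of "\<lambda>i. s (Suc i)"] by (simp add: binary_value_Suc[of s])
next
  case (Suc i)
  have "binary_value (\<lambda>i. s (Suc i)) > 0" using Suc.prems by (intro Suc.IH) auto
  thus ?case using Suc.prems(1) by (simp add: binary_value_Suc[of s])
qed

lemma binary_value_less_1:
  assumes "\<And>i. s i \<le> 1" "s i = 0"
  shows "binary_value s < 1"
  using assms
proof (induction i arbitrary: s)
  case 0
  thus ?case using binary_value_le_1[of "\<lambda>i. s (Suc i)"] by (simp add: binary_value_Suc[of s])
next
  case (Suc i)
  have "binary_value (\<lambda>i. s (Suc i)) < 1" using Suc.prems by (intro Suc.IH) auto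
  moreover have "real (s 0) \<le> 1" using Suc.prems(1)[of 0] by simp
  ultimately have "real (s 0) + binary_value (\<lambda>i. s (Suc i)) < 1 + 1"
    by (intro add_le_less_mono)
  moreover have "binary_value s = (real (s 0) + binary_value (\<lambda>i. s (Suc i))) / 2"
    using Suc.prems(1) by (rule binary_value_Suc)
  ultimately show ?case by simp
qed

lemma binary_value_bounds:
  assumes "s \<in> Sigma2_star"
  shows "0 < binary_value s" "binary_value s < 1"
proof -
  from assms obtain i j where "s i \<noteq> 0" "s j \<noteq> 1" unfolding Sigma2_star_def by blast
  hence "s i = 1" "s j = 0"
    using Sigma2_star_digit[OF assms, of i] Sigma2_star_digit[OF assms, of j] by auto
  thus "0 < binary_value s" "binary_value s < 1"
    using Sigma2_star_le_1[OF assms] binary_value_pos binary_value_less_1 by blast+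
qed

lemma binary_value_less_half_iff:
  assumes "s \<in> Sigma2_star"
  shows "binary_value s < 1 / 2 \<longleftrightarrow> s 0 = 0"
  using Sigma2_star_binary_value_Suc[OF assms]
    binary_value_bounds[OF Sigma2_star_Suc[OF assms]] Sigma2_star_digit[OF assms, of 0]
  by auto

text \<open>Comparison with 1/2 reads off the first digit, because the tail value lies strictly
  between 0 and 1. Equal first digits cancel, and the induction continues with the tails.\<close>

lemma binary_value_inj:
  assumes "s \<in> Sigma2_star" "t \<in> Sigma2_star" "binary_value s = binary_value t"
  shows "s = t"
proof
  fix i
  show "s i = t i" using assms
  proof (induction i arbitrary: s t)
    case 0
    thus ?case
      using binary_value_less_half_iff[of s] binary_value_less_half_iff[of t]
        Sigma2_star_digit[of s 0] Sigma2_star_digit[of t 0] by auto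
  next
    case (Suc i)
    have "s 0 = t 0"
      using Suc.prems binary_value_less_half_iff[of s] binary_value_less_half_iff[of t]
        Sigma2_star_digit[of s 0] Sigma2_star_digit[of t 0] by auto
    hence "binary_value (\<lambda>i. s (Suc i)) = binary_value (\<lambda>i. t (Suc i))"
      using Suc.prems Sigma2_star_binary_value_Suc by simp
    thus ?case using Suc.IH[OF Sigma2_star_Suc Sigma2_star_Suc] Suc.prems by blast
  qed
qed

lemma pi_2_binary_value:
  assumes "s \<in> Sigma2_star"
  shows "pi_2 (binary_value s) = s"
  unfolding pi_2_def
proof (rule the_equality)
  show "s \<in> Sigma2_star \<and> (\<lambda>i. real (s i) / 2 ^ Suc i) sums binary_value s"
    using assms binary_value_sums Sigma2_star_le_1 by blast
next
  fix t
  assume "t \<in> Sigma2_star \<and> (\<lambda>i. real (t i) / 2 ^ Suc i) sums binary_value s"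
  moreover from this have "binary_value t = binary_value s"
    using binary_value_sums[of t] Sigma2_star_le_1 sums_unique2 by blast
  ultimately show "t = s" using assms binary_value_inj by blast
qed

text \<open>Removing a digit lowers the exponent of the denominator; at exponent 0 an integer would
  lie strictly between 0 and 1. The numerator is an integer so that subtracting the removed digit is
  exact.\<close>

lemma binary_value_not_dyadic:
  assumes "s \<in> Sigma2_star"
  shows "binary_value s \<noteq> of_int k / 2 ^ n"
  using assms
proof (induction n arbitrary: s k)
  case 0
  show ?case
  proof
    assume "binary_value s = of_int k / 2 ^ 0"
    with binary_value_bounds[OF 0] have "0 < k" "k < 1" by auto
    thus False by simp
  qed
next
  case (Suc n)
  show ?case
  proof
    assume "binary_value s = of_int k / 2 ^ Suc n"
    hence "(real (s 0) + binary_value (\<lambda>i. s (Suc i))) / 2 = of_int k / 2 ^ Suc n"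
      using Sigma2_star_binary_value_Suc[OF Suc.prems] by simp
    hence "binary_value (\<lambda>i. s (Suc i)) = of_int (k - int (s 0) * 2 ^ n) / 2 ^ n"
      by (simp add: field_simps)
    thus False using Suc.IH[OF Sigma2_star_Suc[OF Suc.prems]] by blast
  qed
qed

lemma binary_value_tail:
  assumes "\<And>i. s i \<le> 1"
  shows "\<exists>k::nat. binary_value s = (real k + binary_value (\<lambda>i. s (i + n))) / 2 ^ n"
  using assms
proof (induction n arbitrary: s)
  case 0
  show ?case by (rule exI[of _ 0]) simp
next
  case (Suc n)
  obtain k :: nat where
    "binary_value (\<lambda>i. s (Suc i)) = (real k + binary_value (\<lambda>i. s (Suc (i + n)))) / 2 ^ n"
    using Suc.IH[of "\<lambda>i. s (Suc i)"] Suc.prems by auto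
  hence eq: "(real (s 0) + binary_value (\<lambda>i. s (Suc i))) / 2 =
      (real (s 0 * 2 ^ n + k) + binary_value (\<lambda>i. s (i + Suc n))) / 2 ^ Suc n"
    by (simp add: field_simps)
  have "binary_value s = (real (s 0) + binary_value (\<lambda>i. s (Suc i))) / 2"
    using Suc.prems by (rule binary_value_Suc)
  also note eq
  finally have "binary_value s =
      (real (s 0 * 2 ^ n + k) + binary_value (\<lambda>i. s (i + Suc n))) / 2 ^ Suc n" .
  thus ?case by blast
qed

text \<open>A constant sequence equals its own tail, so its value v solves v = (c + v) / 2.\<close>

lemma binary_value_const:
  assumes "c \<le> 1"
  shows "binary_value (\<lambda>i. c) = real c"
  using binary_value_Suc[of "\<lambda>i. c"] assms by simp

lemma binary_expansion_exists:
  fixes x :: real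
  assumes "0 \<le> x" "x < 1"
  obtains s where "\<And>i. s i \<le> 1" "binary_value s = x"
proof
  \<comment> \<open>The orbit of x under the doubling map modulo 1; the digit records which half of
    the unit interval the orbit visits.\<close>
  define y where "y i = frac (2 ^ i * x)" for i :: nat
  define s :: "nat \<Rightarrow> nat" where "s i = (if y i < 1 / 2 then 0 else 1)" for i
  show le: "s i \<le> 1" for i by (simp add: s_def)
  have step: "y (Suc i) = 2 * y i - real (s i)" for i
  proof -
    have "y (Suc i) = frac (2 * (2 ^ i * x))" by (simp add: y_def mult.assoc)
    also have "\<dots> = 2 * y i - real (s i)"
    proof (rule frac_unique_iff[THEN iffD2], intro conjI)
      have "2 * (2 ^ i * x) - (2 * y i - real (s i)) = of_int (2 * \<lfloor>2 ^ i * x\<rfloor> + int (s i))"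
        by (simp add: y_def frac_def)
      thus "2 * (2 ^ i * x) - (2 * y i - real (s i)) \<in> \<int>" by (metis Ints_of_int)
      show "0 \<le> 2 * y i - real (s i)" "2 * y i - real (s i) < 1"
        using frac_ge_0[of "2 ^ i * x", folded y_def] frac_lt_1[of "2 ^ i * x", folded y_def]
        by (auto simp: s_def)
    qed
    finally show ?thesis .
  qed
  \<comment> \<open>By telescoping, the remainder after n digits is exactly the scaled orbit point,
    which is at most 1 / 2^n.\<close>
  have "(\<Sum>i<n. real (s i) / 2 ^ Suc i) = x - y n / 2 ^ n" for n
  proof (induction n)
    case 0
    show ?case using assms by (simp add: y_def frac_eq)
  next
    case (Suc n)
    thus ?case by (simp add: step field_simps)
  qed
  moreover have "(\<lambda>n. x - y n / 2 ^ n) \<longlonglongrightarrow> x - 0"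
  proof (rule tendsto_diff[OF tendsto_const], rule Lim_null_comparison)
    have "norm (y n / 2 ^ n) \<le> (1/2) ^ n" for n
      using frac_lt_1[of "2 ^ n * x"]
      by (simp add: y_def power_divide abs_of_nonneg divide_right_mono less_imp_le)
    thus "\<forall>\<^sub>F n in sequentially. norm (y n / 2 ^ n) \<le> (1/2) ^ n" by simp
    show "(\<lambda>n. (1/2::real) ^ n) \<longlonglongrightarrow> 0" by (rule LIMSEQ_power_zero) simp
  qed
  ultimately have "(\<lambda>i. real (s i) / 2 ^ Suc i) sums x" by (simp add: sums_def)
  with binary_value_sums[of s, OF le] show "binary_value s = x" by (rule sums_unique2)
qed

section \<open>Nondyadic numbers and their first binary digit\<close>

definition nondyadic_unit :: "real set" where
  "nondyadic_unit = {0..<1} - dyadic_unit"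

lemma nondyadic_eq_image: "nondyadic_unit = binary_value ` Sigma2_star"
  unfolding nondyadic_unit_def
proof (intro equalityI subsetI)
  fix x assume x: "x \<in> {0..<1} - dyadic_unit"
  then obtain s where s: "\<And>i. s i \<le> 1" "binary_value s = x"
    using binary_expansion_exists[of x] by auto
  have no_tail: "\<not> (\<exists>N. \<forall>i\<ge>N. s i = c)" if c: "c \<le> 1" for c
  proof
    assume "\<exists>N. \<forall>i\<ge>N. s i = c"
    then obtain N where "\<And>i. i \<ge> N \<Longrightarrow> s i = c" by blast
    \<comment> \<open>\<open>Suc N\<close> in place of N, since \<open>dyadic_unit\<close> asks for
      an exponent of at least 1.\<close>
    hence "(\<lambda>i. s (i + Suc N)) = (\<lambda>i. c)" by auto
    with binary_value_tail[of s "Suc N"] s obtain k :: nat where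
      "x = (real k + real c) / 2 ^ Suc N" using binary_value_const[OF c] by auto
    hence "x = real (k + c) / 2 ^ Suc N" by simp
    moreover have "(1::nat) \<le> Suc N" by simp
    ultimately have "x \<in> dyadic_unit" using x unfolding dyadic_unit_def by blast
    thus False using x by blast
  qed
  have "range s \<subseteq> {0, 1}"
  proof (rule image_subsetI)
    show "s i \<in> {0, 1}" for i using s(1)[of i] by auto
  qed
  hence "s \<in> Sigma2_star" using no_tail[of 0] no_tail[of 1] unfolding Sigma2_star_def by blast
  thus "x \<in> binary_value ` Sigma2_star" using s(2) by blast
next
  fix x assume "x \<in> binary_value ` Sigma2_star"
  then obtain s where s: "s \<in> Sigma2_star" "x = binary_value s" by blast
  have "x \<noteq> real k / 2 ^ n" for k n
    using binary_value_not_dyadic[OF s(1), of "int k" n] unfolding s(2) of_int_of_nat_eq .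
  hence "x \<notin> dyadic_unit" unfolding dyadic_unit_def by blast
  thus "x \<in> {0..<1} - dyadic_unit"
    using binary_value_bounds[OF s(1)] s(2) by simp
qed

lemma binary_value_Cons_0:
  assumes "s \<in> Sigma2_star"
  shows "binary_value (case_nat 0 s) = binary_value s / 2"
proof -
  have "case_nat 0 s \<in> Sigma2_star" using assms by (rule Sigma2_star_Cons) simp
  from Sigma2_star_binary_value_Suc[OF this] show ?thesis by simp
qed

lemma binary_value_Cons_1:
  assumes "s \<in> Sigma2_star"
  shows "binary_value (case_nat 1 s) = (1 + binary_value s) / 2"
proof -
  have "case_nat 1 s \<in> Sigma2_star" using assms by (rule Sigma2_star_Cons) simp
  from Sigma2_star_binary_value_Suc[OF this] show ?thesis by simp
qed

lemma nondyadic_bounds: "x \<in> nondyadic_unit \<Longrightarrow> 0 < x \<and> x < 1"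
  unfolding nondyadic_eq_image using binary_value_bounds by blast

lemma nondyadic_half:
  assumes "y \<in> nondyadic_unit"
  shows "y / 2 \<in> nondyadic_unit"
proof -
  obtain s where s: "s \<in> Sigma2_star" "y = binary_value s"
    using assms unfolding nondyadic_eq_image by blast
  have "case_nat 0 s \<in> Sigma2_star" using s(1) by (rule Sigma2_star_Cons) simp
  thus ?thesis
    unfolding s(2) binary_value_Cons_0[OF s(1), symmetric] nondyadic_eq_image by (rule imageI)
qed

lemma nondyadic_half_Suc:
  assumes "y \<in> nondyadic_unit"
  shows "(1 + y) / 2 \<in> nondyadic_unit"
proof -
  obtain s where s: "s \<in> Sigma2_star" "y = binary_value s"
    using assms unfolding nondyadic_eq_image by blast
  have "case_nat 1 s \<in> Sigma2_star" using s(1) by (rule Sigma2_star_Cons) simp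
  thus ?thesis
    unfolding s(2) binary_value_Cons_1[OF s(1), symmetric] nondyadic_eq_image by (rule imageI)
qed

text \<open>The case split on the first binary digit, stated without sequences; the later arguments
  on \<open>phi\<close> and \<open>D2\<close> use it in this form.\<close>

lemma nondyadic_cases:
  assumes "x \<in> nondyadic_unit"
  obtains y where "y \<in> nondyadic_unit" "x = y / 2"
    | y where "y \<in> nondyadic_unit" "x = (1 + y) / 2"
proof -
  obtain s where s: "s \<in> Sigma2_star" "x = binary_value s"
    using assms unfolding nondyadic_eq_image by blast
  define y where "y = binary_value (\<lambda>i. s (Suc i))"
  have "x = (real (s 0) + y) / 2"
    unfolding s(2) y_def by (rule Sigma2_star_binary_value_Suc[OF s(1)])
  moreover have "y \<in> nondyadic_unit"
    unfolding y_def nondyadic_eq_image using Sigma2_star_Suc[OF s(1)] by blast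
  ultimately show ?thesis using that Sigma2_star_digit[OF s(1), of 0] by auto
qed

section \<open>Block decompositions\<close>

definition has_prefix :: "(nat \<Rightarrow> nat) \<Rightarrow> nat list \<Rightarrow> bool" where
  "has_prefix s p \<longleftrightarrow> map s [0..<length p] = p"

definition block_prefix :: "(nat \<Rightarrow> nat) \<Rightarrow> nat \<Rightarrow> nat list" where
  "block_prefix k n = concat (map (\<lambda>i. block (k i)) [0..<n])"

lemma is_block_concat_iff: "is_block_concat k s \<longleftrightarrow> (\<forall>n. has_prefix s (block_prefix k n))"
  by (simp add: is_block_concat_def has_prefix_def block_prefix_def Let_def)

lemma has_prefix_Nil: "has_prefix s []"
  by (simp add: has_prefix_def)

lemma has_prefix_Cons: "has_prefix s (c # p) \<longleftrightarrow> s 0 = c \<and> has_prefix (\<lambda>i. s (Suc i)) p"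
  by (simp add: has_prefix_def map_upt_Suc del: upt_Suc)

lemma has_prefix_block:
  "has_prefix s (block m @ p) \<longleftrightarrow>
     (\<forall>j<m. s j = 1) \<and> s m = 0 \<and> has_prefix (\<lambda>i. s (i + Suc m)) p"
proof (induction m arbitrary: s)
  case 0
  show ?case by (simp add: block_def has_prefix_Cons)
next
  case (Suc m)
  have "has_prefix s (block (Suc m) @ p) \<longleftrightarrow> s 0 = 1 \<and> has_prefix (\<lambda>i. s (Suc i)) (block m @ p)"
    by (simp add: block_def has_prefix_Cons)
  thus ?case by (auto simp: Suc.IH All_less_Suc2)
qed

lemma block_prefix_Suc: "block_prefix k (Suc n) = block (k 0) @ block_prefix (\<lambda>i. k (Suc i)) n"
  by (simp add: block_prefix_def map_upt_Suc del: upt_Suc)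

lemma block_prefix_0: "block_prefix k 0 = []"
  by (simp add: block_prefix_def)

lemma all_nat_iff: "(\<forall>n. P n) \<longleftrightarrow> P 0 \<and> (\<forall>n. P (Suc n))"
  by (metis nat.exhaust)

text \<open>The prefix condition is vacuous for no blocks, and for \<open>Suc n\<close> blocks
  \<open>has_prefix_block\<close> peels off the first one. This replaces the family of finite
  prefixes by a recursion along the sequence.\<close>

lemma is_block_concat_unfold:
  "is_block_concat k s \<longleftrightarrow> (\<forall>j<k 0. s j = 1) \<and> s (k 0) = 0 \<and>
     is_block_concat (\<lambda>i. k (Suc i)) (\<lambda>i. s (i + Suc (k 0)))"
  unfolding is_block_concat_iff
  by (subst all_nat_iff) (auto simp: block_prefix_0 block_prefix_Suc has_prefix_Nil has_prefix_block)

text \<open>The length of the first block is the position of the first 0, hence determined by s; the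
  rest follows by induction on the shifted sequences.\<close>

lemma is_block_concat_unique:
  assumes "is_block_concat k s" "is_block_concat l s"
  shows "k = l"
proof
  fix i
  show "k i = l i" using assms
  proof (induction i arbitrary: k l s)
    case 0
    hence "\<forall>j<k 0. s j = 1" "s (k 0) = 0" "\<forall>j<l 0. s j = 1" "s (l 0) = 0"
      using is_block_concat_unfold by blast+
    thus ?case by (metis linorder_neqE_nat zero_neq_one)
  next
    case (Suc i)
    have "\<forall>j<k 0. s j = 1" "s (k 0) = 0" "\<forall>j<l 0. s j = 1" "s (l 0) = 0"
      using Suc.prems is_block_concat_unfold by blast+
    hence "k 0 = l 0" by (metis linorder_neqE_nat zero_neq_one)
    moreover have "is_block_concat (\<lambda>i. k (Suc i)) (\<lambda>i. s (i + Suc (k 0)))"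
      "is_block_concat (\<lambda>i. l (Suc i)) (\<lambda>i. s (i + Suc (l 0)))"
      using Suc.prems is_block_concat_unfold by blast+
    ultimately show ?case using Suc.IH by simp
  qed
qed

text \<open>The greedy decomposition, cutting after each 0. It serves as the witness that a block
  decomposition exists.\<close>

primrec nth_block :: "nat \<Rightarrow> (nat \<Rightarrow> nat) \<Rightarrow> nat" where
  "nth_block 0 s = (LEAST i. s i = 0)"
| "nth_block (Suc n) s = nth_block n (\<lambda>i. s (i + Suc (LEAST i. s i = 0)))"

lemma is_block_concat_nth_block:
  assumes "s \<in> Sigma2_star"
  shows "is_block_concat (\<lambda>n. nth_block n s) s"
  unfolding is_block_concat_iff
proof
  fix n
  show "has_prefix s (block_prefix (\<lambda>n. nth_block n s) n)" using assms
  proof (induction n arbitrary: s)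
    case 0
    show ?case by (simp add: block_prefix_0 has_prefix_Nil)
  next
    case (Suc n)
    define m where "m = (LEAST i. s i = 0)"
    obtain i where "s i \<noteq> 1" using Suc.prems unfolding Sigma2_star_def by blast
    hence "s i = 0" using Sigma2_star_digit[OF Suc.prems] by blast
    hence "s m = 0" unfolding m_def by (rule LeastI)
    moreover have "\<forall>j<m. s j = 1"
      using not_less_Least[where P = "\<lambda>i. s i = 0"] Sigma2_star_digit[OF Suc.prems]
      unfolding m_def by blast
    moreover have "has_prefix (\<lambda>i. s (i + Suc m))
        (block_prefix (\<lambda>n. nth_block n (\<lambda>i. s (i + Suc m))) n)"
      by (rule Suc.IH[OF Sigma2_star_shift[OF Suc.prems]])
    ultimately show ?case
      unfolding block_prefix_Suc by (simp add: has_prefix_block flip: m_def)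
  qed
qed

lemma eta_eq: "is_block_concat k s \<Longrightarrow> eta s = k"
  unfolding eta_def by (rule the_equality) (auto intro: is_block_concat_unique)

lemma is_block_concat_eta: "s \<in> Sigma2_star \<Longrightarrow> is_block_concat (eta s) s"
  using is_block_concat_nth_block eta_eq by metis

text \<open>A leading 0 is a complete block with no ones, so a new first entry 0 appears.\<close>

lemma eta_Cons_0:
  assumes "s \<in> Sigma2_star"
  shows "eta (case_nat 0 s) = case_nat 0 (eta s)"
  by (rule eta_eq, subst is_block_concat_unfold) (simp add: is_block_concat_eta[OF assms])

text \<open>A leading 1 lengthens the first block by one and leaves the others alone.\<close>

lemma eta_Cons_1:
  assumes "s \<in> Sigma2_star"
  shows "eta (case_nat 1 s) = case_nat (Suc (eta s 0)) (\<lambda>i. eta s (Suc i))"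
proof (rule eta_eq, subst is_block_concat_unfold)
  have "(\<forall>j<eta s 0. s j = 1) \<and> s (eta s 0) = 0 \<and>
      is_block_concat (\<lambda>i. eta s (Suc i)) (\<lambda>i. s (i + Suc (eta s 0)))"
    using is_block_concat_eta[OF assms] is_block_concat_unfold by blast
  thus "(\<forall>j<case_nat (Suc (eta s 0)) (\<lambda>i. eta s (Suc i)) 0. case_nat 1 s j = 1) \<and>
    case_nat 1 s (case_nat (Suc (eta s 0)) (\<lambda>i. eta s (Suc i)) 0) = 0 \<and>
    is_block_concat (\<lambda>i. case_nat (Suc (eta s 0)) (\<lambda>i. eta s (Suc i)) (Suc i))
     (\<lambda>i. case_nat 1 s (i + Suc (case_nat (Suc (eta s 0)) (\<lambda>i. eta s (Suc i)) 0)))"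
    by (auto simp: All_less_Suc2)
qed

lemma is_block_concat_0_imp_0: "is_block_concat (\<lambda>i. 0) s \<Longrightarrow> s n = 0"
proof (induction n arbitrary: s)
  case 0
  thus ?case by (subst (asm) is_block_concat_unfold) simp
next
  case (Suc n)
  hence "is_block_concat (\<lambda>i. 0) (\<lambda>i. s (Suc i))"
    by (subst (asm) is_block_concat_unfold) simp
  thus ?case by (rule Suc.IH)
qed

text \<open>If every block were a single 0, s would be the zero sequence. This is what later keeps
  the continued fraction below 1.\<close>

lemma eta_nonzero:
  assumes "s \<in> Sigma2_star"
  shows "\<exists>i. eta s i \<noteq> 0"
proof (rule ccontr)
  assume "\<not> (\<exists>i. eta s i \<noteq> 0)"
  hence "eta s = (\<lambda>i. 0)" by auto
  hence "s n = 0" for n using is_block_concat_eta[OF assms] is_block_concat_0_imp_0 by metis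
  thus False using assms by (auto simp: Sigma2_star_def)
qed

section \<open>Backward continued fractions\<close>

lemma minus_frac_bounds:
  assumes "\<And>w. w \<in> set ws \<Longrightarrow> w \<ge> 2"
  shows "0 \<le> minus_frac ws \<and> minus_frac ws < 1"
  using assms
proof (induction ws)
  case (Cons w ws)
  have "0 \<le> minus_frac ws \<and> minus_frac ws < 1" "real w \<ge> 2"
    using Cons.IH Cons.prems[of w] Cons.prems by auto
  thus ?case by (auto simp: divide_simps)
qed simp

text \<open>Appending a term replaces the innermost value 0 by 1/v, and t \<mapsto> 1/(w - t) is
  increasing on [0,1). So truncations increase, and their limit exists.\<close>

lemma minus_frac_snoc_ge:
  assumes "\<And>w. w \<in> set (ws @ [v]) \<Longrightarrow> w \<ge> 2"
  shows "minus_frac ws \<le> minus_frac (ws @ [v])"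
  using assms
proof (induction ws)
  case Nil
  thus ?case by simp
next
  case (Cons w ws)
  have "minus_frac ws \<le> minus_frac (ws @ [v])" using Cons by simp
  moreover have "minus_frac (ws @ [v]) < 1" using minus_frac_bounds[of "ws @ [v]"] Cons.prems by simp
  moreover have "real w \<ge> 2" using Cons.prems[of w] by simp
  ultimately show ?case by (simp add: frac_le)
qed

text \<open>The fraction without the leading "1 -" of \<open>pi_R\<close>, which gives it a simple
  recursion in the first term.\<close>

definition backward_cf :: "(nat \<Rightarrow> nat) \<Rightarrow> real" where
  "backward_cf w = lim (\<lambda>n. minus_frac (map w [0..<n]))"

lemma backward_cf_tendsto:
  assumes "\<And>i. w i \<ge> 2"
  shows "(\<lambda>n. minus_frac (map w [0..<n])) \<longlonglongrightarrow> backward_cf w"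
proof -
  have bounds: "0 \<le> minus_frac (map w [0..<n]) \<and> minus_frac (map w [0..<n]) < 1" for n
    using assms by (intro minus_frac_bounds) auto
  have "incseq (\<lambda>n. minus_frac (map w [0..<n]))"
    using assms by (intro incseq_SucI) (auto intro!: minus_frac_snoc_ge)
  moreover have "\<forall>n. minus_frac (map w [0..<n]) \<le> 1" using bounds by (simp add: less_imp_le)
  ultimately obtain L where "(\<lambda>n. minus_frac (map w [0..<n])) \<longlonglongrightarrow> L"
    by (rule incseq_convergent)
  hence "convergent (\<lambda>n. minus_frac (map w [0..<n]))" by (rule convergentI)
  thus ?thesis by (simp add: backward_cf_def convergent_LIMSEQ_iff)
qed

lemma backward_cf_bounds:
  assumes "\<And>i. w i \<ge> 2"
  shows "0 \<le> backward_cf w" "backward_cf w \<le> 1"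
proof -
  have bounds: "0 \<le> minus_frac (map w [0..<n]) \<and> minus_frac (map w [0..<n]) < 1" for n
    using assms by (intro minus_frac_bounds) auto
  show "0 \<le> backward_cf w"
    by (rule LIMSEQ_le_const[OF backward_cf_tendsto[of w, OF assms]]) (use bounds in auto)
  show "backward_cf w \<le> 1"
    by (rule LIMSEQ_le_const2[OF backward_cf_tendsto[of w, OF assms]]) (use bounds in \<open>auto intro: less_imp_le\<close>)
qed

lemma backward_cf_unfold:
  assumes "\<And>i. w i \<ge> 2"
  shows "backward_cf w = 1 / (real (w 0) - backward_cf (\<lambda>i. w (Suc i)))"
proof -
  have "(\<lambda>n. minus_frac (map w [0..<Suc n])) \<longlonglongrightarrow> backward_cf w"
    using assms by (intro LIMSEQ_Suc backward_cf_tendsto)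
  moreover have "minus_frac (map w [0..<Suc n]) =
      1 / (real (w 0) - minus_frac (map (\<lambda>i. w (Suc i)) [0..<n]))" for n
    by (simp add: map_upt_Suc del: upt_Suc)
  ultimately have lim: "(\<lambda>n. 1 / (real (w 0) - minus_frac (map (\<lambda>i. w (Suc i)) [0..<n])))
      \<longlonglongrightarrow> backward_cf w" by simp
  have tail: "(\<lambda>n. minus_frac (map (\<lambda>i. w (Suc i)) [0..<n])) \<longlonglongrightarrow> backward_cf (\<lambda>i. w (Suc i))"
    using assms by (rule backward_cf_tendsto)
  have "backward_cf (\<lambda>i. w (Suc i)) \<le> 1" using assms by (rule backward_cf_bounds)
  moreover have "real (w 0) \<ge> 2" using assms[of 0] by simp
  \<comment> \<open>The limit of the denominators is at least 2 - 1, so the quotient may be passed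
    to the limit.\<close>
  ultimately have "real (w 0) - backward_cf (\<lambda>i. w (Suc i)) \<noteq> 0" by linarith
  with tail have "(\<lambda>n. 1 / (real (w 0) - minus_frac (map (\<lambda>i. w (Suc i)) [0..<n])))
      \<longlonglongrightarrow> 1 / (real (w 0) - backward_cf (\<lambda>i. w (Suc i)))"
    by (intro tendsto_divide tendsto_diff tendsto_const)
  with lim show ?thesis by (rule LIMSEQ_unique)
qed

lemma backward_cf_pos:
  assumes "\<And>i. w i \<ge> 2"
  shows "0 < backward_cf w"
proof -
  have "backward_cf (\<lambda>i. w (Suc i)) \<le> 1" using assms by (rule backward_cf_bounds)
  thus ?thesis using assms[of 0] by (subst backward_cf_unfold[of w, OF assms]) simp
qed

text \<open>A term of at least 3 makes the value starting there at most 1/2, and 1/(w - t) < 1 for t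
  < 1 and w \<ge> 2 carries the strict bound to the front.\<close>

lemma backward_cf_less_1:
  assumes "\<And>i. w i \<ge> 2" "w i \<noteq> 2"
  shows "backward_cf w < 1"
  using assms
proof (induction i arbitrary: w)
  case 0
  have "backward_cf (\<lambda>i. w (Suc i)) \<le> 1" using 0(1) by (rule backward_cf_bounds)
  moreover have "real (w 0) \<ge> 3" using 0(1)[of 0] 0(2) by linarith
  ultimately show ?case by (subst backward_cf_unfold[of w, OF 0(1)]) simp
next
  case (Suc i)
  have "backward_cf (\<lambda>i. w (Suc i)) < 1" using Suc.prems by (rule Suc.IH)
  moreover have "real (w 0) \<ge> 2" using Suc.prems(1)[of 0] by linarith
  ultimately show ?case by (subst backward_cf_unfold[of w, OF Suc.prems(1)]) simp
qed

section \<open>The functional equations of \<open>\<phi>\<close>\<close>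

lemma phi_binary_value:
  assumes "s \<in> Sigma2_star"
  shows "phi (binary_value s) = 1 - backward_cf (\<lambda>i. eta s i + 2)"
proof -
  have "(\<lambda>n. 1 - minus_frac (map (\<lambda>i. eta s i + 2) [0..<n]))
      \<longlonglongrightarrow> 1 - backward_cf (\<lambda>i. eta s i + 2)"
    by (intro tendsto_diff tendsto_const backward_cf_tendsto) auto
  thus ?thesis
    by (simp add: phi_def pi_2_binary_value[OF assms] pi_R_def h_shift_def limI)
qed

lemma phi_bounds:
  assumes "x \<in> nondyadic_unit"
  shows "0 < phi x \<and> phi x < 1"
proof -
  obtain s where s: "s \<in> Sigma2_star" "x = binary_value s"
    using assms unfolding nondyadic_eq_image by blast
  obtain i where "eta s i + 2 \<noteq> 2" using eta_nonzero[OF s(1)] by auto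
  thus ?thesis
    using backward_cf_less_1[of "\<lambda>i. eta s i + 2" i] backward_cf_pos[of "\<lambda>i. eta s i + 2"]
    by (simp add: s phi_binary_value)
qed

text \<open>Halving y prefixes the digit 0, which puts a new term 2 in front of the continued
  fraction.\<close>

lemma phi_half:
  assumes "y \<in> nondyadic_unit"
  shows "phi (y / 2) = phi y / (1 + phi y)"
proof -
  obtain s where s: "s \<in> Sigma2_star" "y = binary_value s"
    using assms unfolding nondyadic_eq_image by blast
  have "phi (y / 2) = 1 - backward_cf (\<lambda>i. case_nat 0 (eta s) i + 2)"
    using phi_binary_value[OF Sigma2_star_Cons[OF s(1), of 0]]
    by (simp add: s binary_value_Cons_0 eta_Cons_0)
  also have "\<dots> = 1 - 1 / (2 - backward_cf (\<lambda>i. eta s i + 2))"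
    by (subst backward_cf_unfold) auto
  also have "\<dots> = 1 - 1 / (1 + phi y)"
    using phi_binary_value[OF s(1)] s(2) by simp
  finally show ?thesis using phi_bounds[OF assms] by (simp add: field_simps)
qed

lemma phi_half_Suc:
  assumes "y \<in> nondyadic_unit"
  shows "phi ((1 + y) / 2) = 1 / (2 - phi y)"
proof -
  obtain s where s: "s \<in> Sigma2_star" "y = binary_value s"
    using assms unfolding nondyadic_eq_image by blast
  \<comment> \<open>The outermost denominator for y. Prefixing the digit 1 raises the first term by
    one, so r becomes 1 + r.\<close>
  define r where "r = real (eta s 0) + 2 - backward_cf (\<lambda>i. eta s (Suc i) + 2)"
  have "1 - phi y = backward_cf (\<lambda>i. eta s i + 2)"
    using phi_binary_value[OF s(1)] s(2) by simp
  also have "\<dots> = 1 / r" by (subst backward_cf_unfold) (auto simp: r_def)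
  finally have r: "1 - phi y = 1 / r" .
  have "phi ((1 + y) / 2) =
      1 - backward_cf (\<lambda>i. case_nat (Suc (eta s 0)) (\<lambda>i. eta s (Suc i)) i + 2)"
    using phi_binary_value[OF Sigma2_star_Cons[OF s(1), of 1]]
    unfolding binary_value_Cons_1[OF s(1)] eta_Cons_1[OF s(1)] s(2) by simp
  also have "\<dots> = 1 - 1 / (1 + r)"
    by (subst backward_cf_unfold) (auto simp: r_def algebra_simps)
  also have "r = 1 / (1 - phi y)" using r by simp
  also have "1 - 1 / (1 + 1 / (1 - phi y)) = 1 / (2 - phi y)"
    using phi_bounds[OF assms] by (simp add: field_simps)
  finally show ?thesis .
qed

lemma phi_half_less: "y \<in> nondyadic_unit \<Longrightarrow> phi (y / 2) < 1 / 2"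
  using phi_bounds[of y] by (simp add: phi_half field_simps)

lemma phi_half_Suc_greater: "y \<in> nondyadic_unit \<Longrightarrow> phi ((1 + y) / 2) > 1 / 2"
  using phi_bounds[of y] by (simp add: phi_half_Suc field_simps)

section \<open>Monotonicity\<close>

text \<open>A quantitative gap makes the induction possible. With equal first digits, removing them
  doubles the gap and both branches are increasing; with different ones, 1/2 separates the values.
  For n = 0 the gap does not fit into (0,1).\<close>

lemma phi_less_if_diff_ge:
  assumes "x \<in> nondyadic_unit" "x' \<in> nondyadic_unit" "x' - x \<ge> 1 / 2 ^ n"
  shows "phi x < phi x'"
  using assms
proof (induction n arbitrary: x x')
  case 0
  thus ?case using nondyadic_bounds[of x] nondyadic_bounds[of x'] by simp
next
  case (Suc n)
  have less: "x < x'"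
  proof -
    have "(0::real) < 1 / 2 ^ Suc n" by simp
    thus ?thesis using Suc.prems(3) by linarith
  qed
  from Suc.prems(1) show ?case
  proof (cases rule: nondyadic_cases)
    case (1 y)
    note y = this
    from Suc.prems(2) show ?thesis
    proof (cases rule: nondyadic_cases)
      case (1 y')
      have "y' - y = 2 * (x' - x)" unfolding y(2) 1(2) by (simp add: diff_divide_distrib)
      hence "1 / 2 ^ n \<le> y' - y" using Suc.prems(3) by simp
      hence "phi y < phi y'" by (rule Suc.IH[OF y(1) 1(1)])
      hence "phi y / (1 + phi y) < phi y' / (1 + phi y')"
        using y(1) 1(1) phi_bounds[of y] phi_bounds[of y'] by (simp add: field_simps)
      thus ?thesis unfolding y(2) 1(2) phi_half[OF y(1)] phi_half[OF 1(1)] .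
    next
      case (2 y')
      show ?thesis unfolding y(2) 2(2)
        using phi_half_less[OF y(1)] phi_half_Suc_greater[OF 2(1)] by (rule less_trans)
    qed
  next
    case (2 y)
    note y = this
    from Suc.prems(2) show ?thesis
    proof (cases rule: nondyadic_cases)
      case (1 y')
      have "x' < x"
        unfolding y(2) 1(2) using nondyadic_bounds[OF y(1)] nondyadic_bounds[OF 1(1)] by simp
      thus ?thesis using less by simp
    next
      case (2 y')
      have "y' - y = 2 * (x' - x)" unfolding y(2) 2(2) by (simp add: add_divide_distrib diff_divide_distrib)
      hence "1 / 2 ^ n \<le> y' - y" using Suc.prems(3) by simp
      hence "phi y < phi y'" by (rule Suc.IH[OF y(1) 2(1)])
      hence "1 / (2 - phi y) < 1 / (2 - phi y')"
        using phi_bounds[OF y(1)] phi_bounds[OF 2(1)] by (intro frac_less2) auto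
      thus ?thesis unfolding y(2) 2(2) phi_half_Suc[OF y(1)] phi_half_Suc[OF 2(1)] .
    qed
  qed
qed

lemma phi_strict_mono: "strict_mono_on nondyadic_unit phi"
proof (rule strict_mono_onI)
  fix x x' :: real
  assume *: "x \<in> nondyadic_unit" "x' \<in> nondyadic_unit" "x < x'"
  obtain n where "(1/2) ^ n < x' - x" using real_arch_pow_inv[of "x' - x" "1/2"] * by auto
  hence "x' - x \<ge> 1 / 2 ^ n" by (simp add: power_divide)
  thus "phi x < phi x'" using * phi_less_if_diff_ge by blast
qed

section \<open>Continuity of increasing functions\<close>

lemma strict_mono_on_dense_image_continuous:
  fixes f :: "real \<Rightarrow> real"
  assumes mono: "strict_mono_on A f"
    and lower: "\<And>b e. b \<in> f ` A \<Longrightarrow> e < b \<Longrightarrow> \<exists>c\<in>f ` A. e < c \<and> c < b"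
    and upper: "\<And>b e. b \<in> f ` A \<Longrightarrow> b < e \<Longrightarrow> \<exists>c\<in>f ` A. b < c \<and> c < e"
  shows "continuous_on A f"
  unfolding continuous_on_iff
proof (intro ballI allI impI)
  fix a e :: real assume a: "a \<in> A" and e: "0 < e"
  \<comment> \<open>Points whose values lie within e of f a on either side; monotonicity traps f x
    between these values as soon as x lies between the points.\<close>
  obtain l where l: "l \<in> A" "f a - e < f l" "f l < f a" using lower[of "f a" "f a - e"] a e by auto
  obtain u where u: "u \<in> A" "f a < f u" "f u < f a + e" using upper[of "f a" "f a + e"] a e by auto
  have "l < a" "a < u"
    using strict_mono_on_less[OF mono] a l u by blast+
  show "\<exists>d>0. \<forall>x\<in>A. dist x a < d \<longrightarrow> dist (f x) (f a) < e"
  proof (intro exI[of _ "min (a - l) (u - a)"] conjI ballI impI)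
    show "0 < min (a - l) (u - a)" using \<open>l < a\<close> \<open>a < u\<close> by simp
    fix x assume x: "x \<in> A" "dist x a < min (a - l) (u - a)"
    hence "l < x" "x < u" by (auto simp: dist_real_def abs_if split: if_splits)
    hence "f l < f x" "f x < f u" using mono x l u by (auto simp: strict_mono_on_def)
    thus "dist (f x) (f a) < e" using l u by (auto simp: dist_real_def)
  qed
qed

section \<open>The inverse branches and irrationality\<close>

text \<open>The inverse of v/(1+v) on [0,1/2) and of 1/(2-v) on [1/2,1). Through \<open>phi\<close>
  it corresponds to removing the first binary digit.\<close>

definition itinerary_map :: "real \<Rightarrow> real" where
  "itinerary_map u = (if u < 1 / 2 then u / (1 - u) else 2 - 1 / u)"

lemma itinerary_map_phi_half:
  assumes "y \<in> nondyadic_unit"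
  shows "itinerary_map (phi (y / 2)) = phi y" "itinerary_map (phi ((1 + y) / 2)) = phi y"
proof -
  show "itinerary_map (phi (y / 2)) = phi y"
    using phi_half_less[OF assms] phi_bounds[OF assms]
    by (simp add: itinerary_map_def phi_half[OF assms] field_simps)
  show "itinerary_map (phi ((1 + y) / 2)) = phi y"
    using phi_half_Suc_greater[OF assms] phi_bounds[OF assms]
    by (simp add: itinerary_map_def phi_half_Suc[OF assms])
qed

text \<open>Descent on the denominator: \<open>itinerary_map\<close> sends p/q to p/(q-p) or to
  (2p-q)/p, and both denominators are smaller than q.\<close>

lemma phi_neq_fraction:
  assumes "x \<in> nondyadic_unit"
  shows "phi x \<noteq> real p / real q"
  using assms
proof (induction q arbitrary: x p rule: less_induct)
  case (less q)
  show ?case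
  proof
    assume eq: "phi x = real p / real q"
    \<comment> \<open>Division by 0 yields 0, so positivity of \<open>phi x\<close> also excludes q
      = 0.\<close>
    have bounds: "0 < p" "p < q"
      using phi_bounds[OF less.prems] unfolding eq by (auto simp: divide_simps split: if_splits)
    from less.prems show False
    proof (cases rule: nondyadic_cases)
      case (1 y)
      have "real p / real q < 1 / 2" using phi_half_less[OF 1(1)] unfolding 1(2)[symmetric] eq .
      hence "phi y = (real p / real q) / (1 - real p / real q)"
        using itinerary_map_phi_half(1)[OF 1(1)] unfolding 1(2)[symmetric] eq
        by (simp add: itinerary_map_def)
      also have "\<dots> = real p / real (q - p)"
        using bounds by (simp add: of_nat_diff divide_simps)
      finally have "phi y = real p / real (q - p)" .
      moreover have "q - p < q" using bounds by simp
      ultimately show False using less.IH 1(1) by blast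
    next
      case (2 y)
      have half: "real p / real q > 1 / 2" using phi_half_Suc_greater[OF 2(1)]
        unfolding 2(2)[symmetric] eq .
      hence "q \<le> 2 * p" using bounds by (simp add: field_simps)
      have "phi y = 2 - 1 / (real p / real q)"
        using half itinerary_map_phi_half(2)[OF 2(1)] unfolding 2(2)[symmetric] eq
        by (simp add: itinerary_map_def)
      also have "\<dots> = real (2 * p - q) / real p"
        using bounds \<open>q \<le> 2 * p\<close> by (simp add: of_nat_diff field_simps)
      finally have "phi y = real (2 * p - q) / real p" .
      thus False using less.IH[OF bounds(2) 2(1)] by blast
    qed
  qed
qed

lemma phi_irrational:
  assumes "x \<in> nondyadic_unit"
  shows "phi x \<notin> \<rat>"
proof
  assume "phi x \<in> \<rat>"
  then obtain p q :: nat where "\<bar>phi x\<bar> = real p / real q" by (rule Rats_abs_nat_div_natE)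
  thus False using phi_neq_fraction[OF assms] phi_bounds[OF assms] by simp
qed

section \<open>Surjectivity\<close>

text \<open>Both branches are Moebius maps with rational coefficients and rational inverses, so a
  rational image would force a rational u.\<close>

lemma itinerary_map_irrational:
  assumes "u \<in> {0..<1} - \<rat>"
  shows "itinerary_map u \<in> {0..<1} - \<rat>"
proof (cases "u < 1 / 2")
  case True
  have "u / (1 - u) \<notin> \<rat>"
  proof
    assume *: "u / (1 - u) \<in> \<rat>"
    have "(u / (1 - u)) / (1 + u / (1 - u)) = u" using True by (simp add: field_simps)
    moreover have "(u / (1 - u)) / (1 + u / (1 - u)) \<in> \<rat>" by (intro Rats_divide Rats_add Rats_1 *)
    ultimately show False using assms by simp
  qed
  thus ?thesis using True assms by (auto simp: itinerary_map_def field_simps)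
next
  case False
  have "2 - 1 / u \<notin> \<rat>"
  proof
    assume *: "2 - 1 / u \<in> \<rat>"
    have "1 / (2 - (2 - 1 / u)) = u" by simp
    moreover have "1 / (2 - (2 - 1 / u)) \<in> \<rat>" by (intro Rats_divide Rats_diff Rats_1 Rats_number_of *)
    ultimately show False using assms by simp
  qed
  thus ?thesis using False assms by (auto simp: itinerary_map_def field_simps)
qed

lemma itinerary_map_funpow_irrational:
  "u \<in> {0..<1} - \<rat> \<Longrightarrow> (itinerary_map ^^ n) u \<in> {0..<1} - \<rat>"
  by (induction n) (simp_all del: Diff_iff add: itinerary_map_irrational)

text \<open>While u and u' lie on the same side of 1/2, the same increasing branch moves both of
  them and the fraction between them. The denominator of the fraction drops each time, so this must
  end.\<close>

lemma itinerary_separates: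
  fixes u u' :: real and p q :: nat
  assumes "u \<in> {0..<1} - \<rat>" "u' \<in> {0..<1} - \<rat>"
    and "u < real p / real q" "real p / real q < u'"
  shows "\<exists>i. ((itinerary_map ^^ i) u < 1 / 2) \<noteq> ((itinerary_map ^^ i) u' < 1 / 2)"
  using assms
proof (induction q arbitrary: u u' p rule: less_induct)
  case (less q)
  have pq: "0 < real p / real q" "real p / real q < 1"
    using less.prems by (meson DiffD1 atLeastLessThan_iff le_less_trans less_trans)+
  hence bounds: "0 < p" "p < q" by (auto simp: divide_simps split: if_splits)
  show ?case
  proof (cases "(u < 1 / 2) = (u' < 1 / 2)")
    case False
    thus ?thesis by (intro exI[of _ 0]) simp
  next
    case same: True
    have "\<exists>i. ((itinerary_map ^^ i) (itinerary_map u) < 1 / 2) \<noteq>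
        ((itinerary_map ^^ i) (itinerary_map u') < 1 / 2)"
    proof (cases "u < 1 / 2")
      case True
      have mono: "a / (1 - a) < b / (1 - b)" if "a < b" "b < 1" for a b :: real
        using that by (simp add: field_simps)
      have eq: "real p / real (q - p) = (real p / real q) / (1 - real p / real q)"
        using bounds by (simp add: of_nat_diff field_simps)
      have maps: "itinerary_map u = u / (1 - u)" "itinerary_map u' = u' / (1 - u')"
        using True same by (simp_all add: itinerary_map_def)
      have "itinerary_map u < real p / real (q - p)"
        unfolding eq maps using less.prems(3) pq(2) by (rule mono)
      moreover have "real p / real (q - p) < itinerary_map u'"
        unfolding eq maps using less.prems(4) by (rule mono) (use less.prems(2) in simp)
      ultimately show ?thesis
        using bounds less.prems(1,2) by (intro less.IH[of "q - p" _ _ p] itinerary_map_irrational) auto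
    next
      case False
      hence half: "1 / 2 < real p / real q" using less.prems(3) by linarith
      hence "q \<le> 2 * p" using bounds by (simp add: field_simps)
      hence eq: "real (2 * p - q) / real p = 2 - 1 / (real p / real q)"
        using bounds by (simp add: of_nat_diff field_simps)
      have mono: "2 - 1 / a < 2 - 1 / b" if "0 < a" "a < b" for a b :: real
        using that by (simp add: frac_less2)
      have maps: "itinerary_map u = 2 - 1 / u" "itinerary_map u' = 2 - 1 / u'"
        using False same by (simp_all add: itinerary_map_def)
      have "itinerary_map u < real (2 * p - q) / real p"
        unfolding eq maps by (rule mono[OF _ less.prems(3)]) (use False in simp)
      moreover have "real (2 * p - q) / real p < itinerary_map u'"
        unfolding eq maps using pq(1) less.prems(4) by (rule mono)
      ultimately show ?thesis
        using bounds less.prems(1,2)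
        by (intro less.IH[of p _ _ "2 * p - q"] itinerary_map_irrational) auto
    qed
    then obtain i where "((itinerary_map ^^ i) (itinerary_map u) < 1 / 2) \<noteq>
        ((itinerary_map ^^ i) (itinerary_map u') < 1 / 2)" ..
    thus ?thesis by (intro exI[of _ "Suc i"]) (simp add: funpow_swap1)
  qed
qed

lemma irrational_unit_bounds: "u \<in> {0..<1} - \<rat> \<Longrightarrow> 0 < u \<and> u < 1" for u :: real
  by (cases "u = 0") auto

text \<open>Each step of the left branch lowers 1/u by exactly 1, while 1/u must stay
  positive.\<close>

lemma itinerary_leaves_left:
  assumes "u \<in> {0..<1} - \<rat>"
  shows "\<exists>i. \<not> (itinerary_map ^^ i) u < 1 / 2"
proof (rule ccontr)
  assume "\<not> (\<exists>i. \<not> (itinerary_map ^^ i) u < 1 / 2)"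
  hence left: "(itinerary_map ^^ i) u < 1 / 2" for i by blast
  have bounds: "0 < (itinerary_map ^^ i) u \<and> (itinerary_map ^^ i) u < 1" for i
    using itinerary_map_funpow_irrational[OF assms] by (rule irrational_unit_bounds)
  have eq: "1 / (itinerary_map ^^ i) u = 1 / u - real i" for i
  proof (induction i)
    case (Suc i)
    have "1 / (itinerary_map ^^ Suc i) u = 1 / (itinerary_map ^^ i) u - 1"
      using left[of i] bounds[of i] by (simp add: itinerary_map_def diff_divide_distrib)
    thus ?case using Suc by simp
  qed simp
  obtain n where "1 / u < real n" using reals_Archimedean2 by blast
  hence "1 / (itinerary_map ^^ n) u < 0" by (simp add: eq)
  thus False using bounds[of n] by (simp add: divide_less_0_iff)
qed

text \<open>On the right branch the quantity that drops by 1 is 1/(1 - u).\<close>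

lemma itinerary_leaves_right:
  assumes "u \<in> {0..<1} - \<rat>"
  shows "\<exists>i. (itinerary_map ^^ i) u < 1 / 2"
proof (rule ccontr)
  assume "\<not> (\<exists>i. (itinerary_map ^^ i) u < 1 / 2)"
  hence right: "\<not> (itinerary_map ^^ i) u < 1 / 2" for i by blast
  have bounds: "0 < (itinerary_map ^^ i) u \<and> (itinerary_map ^^ i) u < 1" for i
    using itinerary_map_funpow_irrational[OF assms] by (rule irrational_unit_bounds)
  have eq: "1 / (1 - (itinerary_map ^^ i) u) = 1 / (1 - u) - real i" for i
  proof (induction i)
    case (Suc i)
    have "1 / (1 - (2 - 1 / v)) = 1 / (1 - v) - 1" if "0 < v" "v < 1" for v :: real
      using that by (simp add: field_simps)
    hence "1 / (1 - (itinerary_map ^^ Suc i) u) = 1 / (1 - (itinerary_map ^^ i) u) - 1"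
      using right[of i] bounds[of i] by (simp add: itinerary_map_def)
    thus ?case using Suc by simp
  qed simp
  obtain n where "1 / (1 - u) < real n" using reals_Archimedean2 by blast
  hence "1 / (1 - (itinerary_map ^^ n) u) < 0" by (simp add: eq)
  thus False using bounds[of n] by (simp add: divide_less_0_iff)
qed

lemma itinerary_map_phi_binary_value:
  assumes "s \<in> Sigma2_star"
  shows "itinerary_map (phi (binary_value s)) = phi (binary_value (\<lambda>i. s (Suc i)))"
    and "phi (binary_value s) < 1 / 2 \<longleftrightarrow> s 0 = 0"
proof -
  define y where "y = binary_value (\<lambda>i. s (Suc i))"
  have y: "y \<in> nondyadic_unit"
    unfolding y_def nondyadic_eq_image using Sigma2_star_Suc[OF assms] by blast
  have "binary_value s = (real (s 0) + y) / 2"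
    unfolding y_def by (rule Sigma2_star_binary_value_Suc[OF assms])
  hence "binary_value s = y / 2 \<and> s 0 = 0 \<or> binary_value s = (1 + y) / 2 \<and> s 0 = 1"
    using Sigma2_star_digit[OF assms, of 0] by auto
  thus "itinerary_map (phi (binary_value s)) = phi y" "phi (binary_value s) < 1 / 2 \<longleftrightarrow> s 0 = 0"
    using itinerary_map_phi_half[OF y] phi_half_less[OF y] phi_half_Suc_greater[OF y]
    by (metis, metis less_asym zero_neq_one)
qed

text \<open>This tells how to find a preimage of u: its binary digits must be the itinerary of u
  relative to 1/2.\<close>

lemma itinerary_phi_binary_value:
  assumes "s \<in> Sigma2_star"
  shows "(itinerary_map ^^ n) (phi (binary_value s)) < 1 / 2 \<longleftrightarrow> s n = 0"
  using assms
proof (induction n arbitrary: s)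
  case 0
  thus ?case using itinerary_map_phi_binary_value(2) by simp
next
  case (Suc n)
  thus ?case using Suc.IH[OF Sigma2_star_Suc[OF Suc.prems]]
    by (simp add: funpow_swap1 itinerary_map_phi_binary_value(1))
qed

text \<open>Two distinct numbers have a rational between them, and
  \<open>itinerary_separates\<close> then gives different itineraries.\<close>

lemma itinerary_inj:
  fixes u u' :: real
  assumes "u \<in> {0..<1} - \<rat>" "u' \<in> {0..<1} - \<rat>"
    and same: "\<And>i. ((itinerary_map ^^ i) u < 1 / 2) = ((itinerary_map ^^ i) u' < 1 / 2)"
  shows "u = u'"
proof -
  have not_less: "\<not> a < b"
    if ab: "a \<in> {0..<1} - \<rat>" "b \<in> {0..<1} - \<rat>"
      and eq: "\<And>i. ((itinerary_map ^^ i) a < 1 / 2) = ((itinerary_map ^^ i) b < 1 / 2)"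
    for a b :: real
  proof
    assume "a < b"
    then obtain r where r: "r \<in> \<rat>" "a < r" "r < b" using Rats_dense_in_real by blast
    obtain p q :: nat where "\<bar>r\<bar> = real p / real q" using r(1) by (rule Rats_abs_nat_div_natE)
    hence "r = real p / real q" using r(2) irrational_unit_bounds[OF ab(1)] by simp
    thus False using itinerary_separates[OF ab] r eq by blast
  qed
  show ?thesis using not_less[OF assms] not_less[OF assms(2,1)] same by force
qed

lemma phi_surj:
  assumes "u \<in> {0..<1} - \<rat>"
  shows "u \<in> phi ` nondyadic_unit"
proof -
  define s :: "nat \<Rightarrow> nat" where "s i = (if (itinerary_map ^^ i) u < 1 / 2 then 0 else 1)" for i
  have zeros: "\<exists>i\<ge>N. s i = 0" and ones: "\<exists>i\<ge>N. s i = 1" for N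
  proof -
    let ?v = "(itinerary_map ^^ N) u"
    \<comment> \<open>Starting from an arbitrary orbit point yields both digits beyond every N,
      which rules out constant tails.\<close>
    have v: "?v \<in> {0..<1} - \<rat>" by (rule itinerary_map_funpow_irrational[OF assms])
    have s_add: "s (i + N) = (if (itinerary_map ^^ i) ?v < 1 / 2 then 0 else 1)" for i
      by (simp add: s_def funpow_add)
    obtain i j where "(itinerary_map ^^ i) ?v < 1 / 2" "\<not> (itinerary_map ^^ j) ?v < 1 / 2"
      using itinerary_leaves_right[OF v] itinerary_leaves_left[OF v] by blast
    hence "s (i + N) = 0" "s (j + N) = 1" by (simp_all add: s_add)
    thus "\<exists>i\<ge>N. s i = 0" "\<exists>i\<ge>N. s i = 1" using le_add2 by blast+
  qed
  have "\<not> (\<exists>N. \<forall>i\<ge>N. s i = 1)" using zeros by (metis zero_neq_one)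
  moreover have "\<not> (\<exists>N. \<forall>i\<ge>N. s i = 0)" using ones by (metis zero_neq_one)
  moreover have "range s \<subseteq> {0, 1}" by (auto simp: s_def)
  ultimately have s: "s \<in> Sigma2_star" unfolding Sigma2_star_def by blast
  hence x: "binary_value s \<in> nondyadic_unit" unfolding nondyadic_eq_image by blast
  have "phi (binary_value s) = u"
  proof (rule itinerary_inj[OF _ assms])
    show "phi (binary_value s) \<in> {0..<1} - \<rat>" using phi_bounds[OF x] phi_irrational[OF x] by simp
    show "((itinerary_map ^^ i) (phi (binary_value s)) < 1 / 2) = ((itinerary_map ^^ i) u < 1 / 2)"
      for i
      unfolding itinerary_phi_binary_value[OF s] by (simp add: s_def)
  qed
  thus ?thesis using x by blast
qed

lemma phi_image: "phi ` nondyadic_unit = {0..<1} - \<rat>"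
  using phi_surj phi_bounds phi_irrational by force

section \<open>From increasing bijection to homeomorphism\<close>

lemma nondyadic_unit_complement_countable: "countable ({0<..<1} - nondyadic_unit)"
proof (rule countable_subset[OF _ countable_rat])
  show "{0<..<1} - nondyadic_unit \<subseteq> \<rat>"
    by (auto simp: nondyadic_unit_def dyadic_unit_def)
qed

lemma cocountable_between:
  fixes a b :: real
  assumes "countable ({0<..<1} - B)" "0 \<le> a" "a < b" "b \<le> 1"
  shows "\<exists>c\<in>B. a < c \<and> c < b"
proof -
  have "uncountable {a<..<b}" using \<open>a < b\<close> by (simp add: uncountable_open_interval)
  hence "\<not> {a<..<b} \<subseteq> {0<..<1} - B" using assms(1) countable_subset by blast
  thus ?thesis using assms by fastforce
qed

text \<open>An image that misses only countably many points of (0,1) is dense there. The criterion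
  serves \<open>phi\<close> and its inverse alike, as dyadics and rationals are countable.\<close>

lemma strict_mono_on_cocountable_continuous:
  fixes f :: "real \<Rightarrow> real"
  assumes "strict_mono_on A f" "f ` A \<subseteq> {0<..<1}" "countable ({0<..<1} - f ` A)"
  shows "continuous_on A f"
proof (rule strict_mono_on_dense_image_continuous[OF assms(1)])
  fix b e :: real
  assume b: "b \<in> f ` A"
  hence "0 < b" "b < 1" using assms(2) by auto
  thus "\<exists>c\<in>f ` A. e < c \<and> c < b" if "e < b"
    \<comment> \<open>The bound e may lie outside [0,1], so it is clipped to 0 here and to 1
      below.\<close>
    using cocountable_between[OF assms(3), of "max 0 e" b] that by auto
  show "\<exists>c\<in>f ` A. b < c \<and> c < e" if "b < e"
    using cocountable_between[OF assms(3), of b "min 1 e"] that \<open>0 < b\<close> \<open>b < 1\<close> by auto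
qed

lemma phi_homeomorphism:
  "homeomorphism nondyadic_unit ({0..<1} - \<rat>) phi (inv_into nondyadic_unit phi)"
proof -
  let ?A = nondyadic_unit and ?B = "{0..<1::real} - \<rat>" and ?g = "inv_into nondyadic_unit phi"
  have inj: "inj_on phi ?A" using phi_strict_mono by (rule strict_mono_on_imp_inj_on)
  have g_image: "?g ` ?B = ?A" unfolding phi_image[symmetric] using inj by simp
  have "strict_mono_on ?B ?g"
  proof (rule strict_mono_onI)
    fix u v assume uv: "u \<in> ?B" "v \<in> ?B" "u < v"
    hence "phi (?g u) < phi (?g v)" by (simp add: f_inv_into_f phi_image)
    moreover have "?g u \<in> ?A" "?g v \<in> ?A" using uv g_image by blast+
    ultimately show "?g u < ?g v" using strict_mono_on_less[OF phi_strict_mono] by blast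
  qed
  moreover have "?g ` ?B \<subseteq> {0<..<1}" unfolding g_image using nondyadic_bounds by auto
  ultimately have "continuous_on ?B ?g"
    by (rule strict_mono_on_cocountable_continuous)
       (simp add: g_image nondyadic_unit_complement_countable)
  moreover have "continuous_on ?A phi"
  proof (rule strict_mono_on_cocountable_continuous[OF phi_strict_mono])
    show "phi ` ?A \<subseteq> {0<..<1}" using phi_bounds by auto
    show "countable ({0<..<1} - phi ` ?A)"
      unfolding phi_image by (rule countable_subset[OF _ countable_rat]) auto
  qed
  ultimately show ?thesis
    unfolding homeomorphism_def using inj phi_image g_image
    by (auto simp: f_inv_into_f simp del: Diff_iff)
qed

section \<open>The conjugacy\<close>

text \<open>Measured by the distance to 1, the intervals are dyadic shells, which y \<mapsto>
  (1+y)/2 shifts by one. Writing the index as \<open>Suc m\<close> removes the natural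
  subtraction.\<close>

lemma odometer_interval_iff:
  "x \<in> odometer_interval (Suc m) \<longleftrightarrow> 1 / 2 ^ Suc m < 1 - x \<and> 1 - x \<le> 1 / 2 ^ m"
proof -
  have "(2 ^ k - 1) / 2 ^ k = 1 - 1 / (2 ^ k :: real)" for k :: nat
    by (simp add: diff_divide_distrib)
  hence "odometer_interval (Suc m) = {1 - 1 / 2 ^ m ..< 1 - 1 / 2 ^ Suc m}"
    unfolding odometer_interval_def by (simp only: diff_Suc_1)
  thus ?thesis by auto
qed

lemma odometer_interval_unique:
  assumes "x \<in> odometer_interval (Suc m)" "x \<in> odometer_interval (Suc n)"
  shows "m = n"
proof -
  have not_less: "\<not> k < l"
    if "x \<in> odometer_interval (Suc k)" "x \<in> odometer_interval (Suc l)" for k l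
  proof
    assume "k < l"
    hence "(1::real) / 2 ^ l \<le> 1 / 2 ^ Suc k" by (intro divide_left_mono power_increasing) auto
    thus False using that unfolding odometer_interval_iff by linarith
  qed
  show ?thesis using not_less[OF assms] not_less[OF assms(2,1)] by linarith
qed

lemma D2_eq:
  assumes "x \<in> odometer_interval (Suc m)"
  shows "D2 x = x + 3 / 2 ^ Suc m - 1"
proof -
  have "(THE n. n \<ge> 1 \<and> x \<in> odometer_interval n) = Suc m"
  proof (rule the_equality)
    fix n assume n: "n \<ge> 1 \<and> x \<in> odometer_interval n"
    then obtain k where "n = Suc k" by (cases n) auto
    thus "n = Suc m" using n assms odometer_interval_unique by blast
  qed (use assms in simp)
  thus ?thesis by (simp add: D2_def)
qed

lemma odometer_interval_exists:
  assumes "0 \<le> x" "x < 1"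
  shows "\<exists>m. x \<in> odometer_interval (Suc m)"
proof -
  have "\<exists>n. (1/2) ^ n < 1 - x" using assms by (intro real_arch_pow_inv) auto
  hence ex: "\<exists>n. 1 / 2 ^ n < 1 - x" by (simp add: power_divide)
  \<comment> \<open>Minimality supplies the upper bound on 1 - x; n is not 0 because 1 - x \<le>
    1.\<close>
  define n where "n = (LEAST n. 1 / 2 ^ n < 1 - x)"
  have n: "1 / 2 ^ n < 1 - x" unfolding n_def using ex by (rule LeastI_ex)
  then obtain m where m: "n = Suc m" using assms by (cases n) auto
  hence "\<not> 1 / 2 ^ m < 1 - x" unfolding n_def by (intro not_less_Least) simp
  thus ?thesis using n m by (auto simp: odometer_interval_iff)
qed

lemma D2_half: "0 \<le> y \<Longrightarrow> y < 1 \<Longrightarrow> D2 (y / 2) = (1 + y) / 2"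
  by (subst D2_eq[of _ 0]) (auto simp: odometer_interval_iff field_simps)

text \<open>Addition with carry: the leading 1 becomes 0 and the odometer acts on the tail. In
  \<open>D2_half\<close> the leading 0 becomes 1 and there is no carry.\<close>

lemma D2_half_Suc:
  assumes "0 \<le> y" "y < 1"
  shows "D2 ((1 + y) / 2) = D2 y / 2"
proof -
  obtain m where m: "y \<in> odometer_interval (Suc m)" using odometer_interval_exists assms by blast
  hence "(1 + y) / 2 \<in> odometer_interval (Suc (Suc m))"
    by (simp add: odometer_interval_iff field_simps)
  thus ?thesis using m by (simp add: D2_eq field_simps)
qed

text \<open>Induction on the number of leading ones: removing one doubles 1 - x, which stays below
  1, so a leading 0 is reached.\<close>

lemma nondyadic_induct [consumes 1, case_names half half_Suc]:
  assumes "x \<in> nondyadic_unit"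
    and half: "\<And>y. y \<in> nondyadic_unit \<Longrightarrow> P (y / 2)"
    and half_Suc: "\<And>y. y \<in> nondyadic_unit \<Longrightarrow> P y \<Longrightarrow> P ((1 + y) / 2)"
  shows "P x"
proof -
  have "\<exists>n. (1/2) ^ n < 1 - x"
    using nondyadic_bounds[OF assms(1)] by (intro real_arch_pow_inv) auto
  then obtain n where "1 / 2 ^ n < 1 - x" by (auto simp: power_divide)
  thus ?thesis using assms(1)
  proof (induction n arbitrary: x)
    case 0
    thus ?case using nondyadic_bounds[of x] by simp
  next
    case (Suc n)
    from Suc.prems(2) show ?case
    proof (cases rule: nondyadic_cases)
      case (1 y)
      show ?thesis unfolding 1(2) using 1(1) by (rule half)
    next
      case (2 y)
      have "1 - y = 2 * (1 - x)" unfolding 2(2) by (simp add: field_simps)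
      hence "1 / 2 ^ n < 1 - y" using Suc.prems(1) by simp
      hence "P y" using 2(1) by (rule Suc.IH)
      with 2(1) show ?thesis unfolding 2(2) by (rule half_Suc)
    qed
  qed
qed

section \<open>The map T on the two branches\<close>

lemma T_map_left:
  assumes "0 < v" "v < 1"
  shows "T_map (v / (1 + v)) = 1 / (2 - v)"
proof -
  \<comment> \<open>The integer part is 1, so the denominator of T becomes 3 - (1 + v).\<close>
  have "1 / (1 - v / (1 + v)) = 1 + v" using assms by (simp add: field_simps)
  moreover have "\<lfloor>1 + v\<rfloor> = 1" using assms by (simp add: floor_eq_iff)
  ultimately show ?thesis by (simp add: T_map_def)
qed

text \<open>Passing from v to 1/(2 - v) raises r = 1/(1 - v) and its integer part by 1, so the
  denominator d of T becomes d + 1.\<close>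

lemma T_map_right:
  assumes "0 < v" "v < 1"
  shows "T_map (1 / (2 - v)) = T_map v / (1 + T_map v)"
proof -
  define r where "r = 1 / (1 - v)"
  define d where "d = 2 * of_int \<lfloor>r\<rfloor> + 1 - r"
  have "r > 1" using assms by (simp add: r_def)
  hence "\<lfloor>r\<rfloor> \<ge> 1" by simp
  hence "d > 0" unfolding d_def by linarith
  have "1 / (1 - 1 / (2 - v)) = 1 + r" using assms by (simp add: r_def field_simps)
  hence "T_map (1 / (2 - v)) = 1 / (d + 1)" by (simp add: T_map_def d_def)
  moreover have "T_map v = 1 / d" by (simp add: T_map_def d_def r_def)
  moreover have "1 / (d + 1) = (1 / d) / (1 + 1 / d)" using \<open>d > 0\<close> by (simp add: field_simps)
  ultimately show ?thesis by simp
qed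

text \<open>Membership of \<open>D2 x\<close> is proved along with the equation, since
  \<open>phi_half\<close> has to be applied at \<open>D2 y\<close> in the carry case.\<close>

lemma phi_D2:
  assumes "x \<in> nondyadic_unit"
  shows "D2 x \<in> nondyadic_unit \<and> phi (D2 x) = T_map (phi x)"
  using assms
proof (induction rule: nondyadic_induct)
  case (half y)
  thus ?case using nondyadic_bounds[of y] phi_bounds[of y]
    by (simp add: D2_half nondyadic_half_Suc phi_half phi_half_Suc T_map_left)
next
  case (half_Suc y)
  thus ?case using nondyadic_bounds[of y] phi_bounds[of y]
    by (simp add: D2_half_Suc nondyadic_half phi_half phi_half_Suc T_map_right)
qed

theorem theorem5p1:
  "(\<exists>\<psi>. homeomorphism ({0..<1} - dyadic_unit) ({0..<1} - \<rat>) phi \<psi>) \<and>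
   D2 ` ({0..<1} - dyadic_unit) \<subseteq> {0..<1} - dyadic_unit \<and>
   (\<forall>x \<in> {0..<1} - dyadic_unit. (phi \<circ> D2) x = (T_map \<circ> phi) x)"
  unfolding nondyadic_unit_def[symmetric] using phi_homeomorphism phi_D2 by auto

end
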